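(* For all integers $n\ge 2$, $k\ge 3$ and $d\ge 1$ there exists a system of $k(n-1)$ tropical polynomials in $n$ variables, of tropical degree $4d$, such that the number of isolated solutions of this system in $\mathbb{R}^n$ equals $2(k-1)^{n-1}d^n$.
   Context: A tropical polynomial $f$ in $n$ variables is given by a nonempty finite set of tropical monomials $Q_j(x)=a_j+i_{j1}x_1+\cdots+i_{jn}x_n$ with $a_j\in\mathbb{R}$ and pairwise distinct exponent vectors $(i_{j1},\dots,i_{jn})\in\mathbb{Z}_{\ge 0}^n$; $f(x)=\min_j Q_j(x)$. The tropical degree of $Q_j$ is $i_{j1}+\cdots+i_{jn}$, and the tropical degree of $f$ is the maximum of the degrees of its monomials. Monomials may be missing from $f$ (i.e. have coefficient $\infty$). A point $x\in\mathbb{R}^n$ is a tropical zero of $f$ if $\min_j Q_j(x)$ is attained for at least two different values of $j$. A solution of a system is a point of $\mathbb{R}^n$ that is a tropical zero of every polynomial of the system; an isolated solution is an isolated point of the set of all solutions. *)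

theory Defs
  imports "HOL-Analysis.Analysis"
begin

text \<open>
  A tropical polynomial is represented by its partial coefficient function: the domain is the
  set of exponent vectors that occur, and an exponent vector outside the domain is a missing
  monomial (coefficient \<open>\<infinity>\<close>).
\<close>

type_synonym 'n trop_poly = "nat ^ 'n \<rightharpoonup> real"

definition is_trop_poly :: "'n::finite trop_poly \<Rightarrow> bool" where
  "is_trop_poly f \<longleftrightarrow> finite (dom f) \<and> dom f \<noteq> {}"

text \<open>The monomial with exponent vector \<open>e\<close>; only meaningful for \<open>e \<in> dom f\<close>.\<close>

definition trop_monom :: "'n::finite trop_poly \<Rightarrow> nat ^ 'n \<Rightarrow> real ^ 'n \<Rightarrow> real" where
  "trop_monom f e x = the (f e) + (\<Sum>i\<in>UNIV. real (e $ i) * x $ i)"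

definition trop_eval :: "'n::finite trop_poly \<Rightarrow> real ^ 'n \<Rightarrow> real" where
  "trop_eval f x = Min ((\<lambda>e. trop_monom f e x) ` dom f)"

definition trop_degree :: "'n::finite trop_poly \<Rightarrow> nat" where
  "trop_degree f = Max ((\<lambda>e. \<Sum>i\<in>UNIV. e $ i) ` dom f)"

definition trop_zero :: "'n::finite trop_poly \<Rightarrow> real ^ 'n \<Rightarrow> bool" where
  "trop_zero f x \<longleftrightarrow>
     (\<exists>e\<in>dom f. \<exists>e'\<in>dom f. e \<noteq> e' \<and>
        trop_monom f e x = trop_eval f x \<and> trop_monom f e' x = trop_eval f x)"

definition trop_solutions :: "'n::finite trop_poly set \<Rightarrow> (real ^ 'n) set" where
  "trop_solutions F = {x. \<forall>f\<in>F. trop_zero f x}"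

end

theory Submission
  imports Defs
begin

text \<open>
  Fix one coordinate \<open>y\<close>. For each other coordinate \<open>x\<close> the system contains \<open>k\<close> polynomials in \<open>x\<close>
  and \<open>y\<close> only. Without perturbation such a polynomial would be a tropical sum of all
  monomials of bidegree at most \<open>(2d, 2d)\<close>, with coefficients that split as a function of the
  \<open>x\<close>-exponent plus a function of the \<open>y\<close>-exponent; its zero set is a grid of \<open>2d\<close> vertical and
  \<open>2d\<close> horizontal lines. Now delete all monomials whose two exponents are both odd. Along a horizontal
  line \<open>y = - s\<close> two monomials tie that share their \<open>x\<close>-exponent and have consecutive
  \<open>y\<close>-exponents; where the dominant \<open>x\<close>-exponent is odd one of the two is gone, and the line is
  interrupted. So every horizontal line acquires \<open>d\<close> open gaps, one for each odd
  \<open>x\<close>-exponent (\<open>gap_poly_zero_on_grid\<close>).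

  The positions of the gaps are free. In the coordinate \<open>- x\<close>, let the \<open>j\<close>-th polynomial have the gaps
  \<open>(g, g + 1)\<close> with \<open>g = m (k + 1) + j\<close> for \<open>m < d\<close>. For \<open>j = 0, \<dots>, k - 1\<close> they form \<open>d\<close> blocks of
  \<open>k\<close> adjacent gaps, and consecutive blocks are a unit apart. What the common zero set
  keeps of a horizontal line is the closed complement of all gaps: the \<open>k - 1\<close> interior
  integers of each block, which are isolated, and the intervals and rays between and beyond the
  blocks (\<open>isolated_in_gapped_line\<close>, \<open>card_adjacent_gap_starts\<close>).

  Vertical edges and displaced pieces of horizontal edges add nothing: as \<open>k \<ge> 3\<close>, every \<open>x\<close>
  stays away from all closed gaps of some polynomial, and near such an \<open>x\<close> the zero set of that
  polynomial consists of the horizontal lines alone (\<open>exists_generic_index\<close>,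
  \<open>gap_poly_zero_imp_grid\<close>). Hence the solution set of the whole system is a box, with \<open>2d\<close> values
  of \<open>y\<close> and the same gapped line in each other coordinate (\<open>trop_solutions_gap_system\<close>). A point
  of a finite product is isolated iff each coordinate is (\<open>isolated_in_box_iff\<close>), and this gives \<open>2d \<cdot> ((k - 1) d)\<^sup>n\<^sup>-\<^sup>1\<close>.
\<close>

section \<open>Isolated points and cardinality of boxes\<close>

lemma isolated_in_box_iff:
  fixes S :: "'n::finite \<Rightarrow> 'a::topological_space set" and x :: "'a ^ 'n"
  shows "x isolated_in {x. \<forall>i. x $ i \<in> S i} \<longleftrightarrow> (\<forall>i. x $ i isolated_in S i)"
proof (intro iffI allI)
  fix i
  assume "x isolated_in {x. \<forall>i. x $ i \<in> S i}"
  then obtain T where xS: "\<And>i. x $ i \<in> S i" and T: "open T" "T \<inter> {x. \<forall>i. x $ i \<in> S i} = {x}"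
    unfolding isolated_in_def by blast
  then have "x \<in> T" by blast
  with T(1) obtain A where A: "\<And>l. open (A l)" "\<And>l. x $ l \<in> A l" "\<And>y. \<forall>l. y $ l \<in> A l \<Longrightarrow> y \<in> T"
    unfolding open_vec_def by metis
  have "A i \<inter> S i = {x $ i}"
  proof (intro equalityI subsetI)
    fix t assume t: "t \<in> A i \<inter> S i"
    \<comment> \<open>Move only coordinate \<open>i\<close>, so that isolation of \<open>x\<close> in the box applies.\<close>
    define y where "y = (\<chi> l. if l = i then t else x $ l)"
    have "y \<in> T" using A t by (auto simp: y_def)
    moreover have "\<forall>l. y $ l \<in> S l" using xS t by (auto simp: y_def)
    ultimately have "y = x" using T(2) by blast
    then have "y $ i = x $ i" by simp
    then show "t \<in> {x $ i}" by (simp add: y_def)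
  qed (use A xS in auto)
  then show "x $ i isolated_in S i" unfolding isolated_in_def using A(1) xS by blast
next
  assume "\<forall>i. x $ i isolated_in S i"
  then have xS: "\<forall>i. x $ i \<in> S i" and "\<forall>i. \<exists>T. open T \<and> T \<inter> S i = {x $ i}"
    unfolding isolated_in_def by auto
  then obtain A where "\<forall>i. open (A i) \<and> A i \<inter> S i = {x $ i}" by (auto dest!: choice)
  with xS have A: "\<And>i. x $ i \<in> S i" "\<And>i. open (A i)" "\<And>i. A i \<inter> S i = {x $ i}" by auto
  have "open {y. \<forall>i. y $ i \<in> A i}" using A(2) by (simp add: open_vector_box)
  moreover have "{y. \<forall>i. y $ i \<in> A i} \<inter> {x. \<forall>i. x $ i \<in> S i} = {x}"
  proof -
    have "y = x" if "\<forall>i. y $ i \<in> A i" "\<forall>i. y $ i \<in> S i" for y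
      using that A(3) by (simp add: vec_eq_iff) blast
    moreover have "x $ i \<in> A i" for i using A(3) by blast
    ultimately show ?thesis using A(1) by blast
  qed
  ultimately show "x isolated_in {x. \<forall>i. x $ i \<in> S i}"
    unfolding isolated_in_def using A(1) by blast
qed

lemma bij_betw_vec_nth_PiE:
  "bij_betw vec_nth {x :: 'a ^ 'n::finite. \<forall>i. x $ i \<in> S i} (PiE UNIV S)"
  by (rule bij_betwI[where g = vec_lambda]) (simp_all add: PiE_UNIV_domain Pi_iff fun_eq_iff)

lemma card_box_vec: "card {x :: 'a ^ 'n::finite. \<forall>i. x $ i \<in> S i} = (\<Prod>i\<in>UNIV. card (S i))"
  using bij_betw_same_card[OF bij_betw_vec_nth_PiE[of S]] card_PiE[of UNIV S] by simp

lemma finite_box_vec: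
  "(\<And>i. finite (S i)) \<Longrightarrow> finite {x :: 'a ^ 'n::finite. \<forall>i. x $ i \<in> S i}"
  using bij_betw_finite[OF bij_betw_vec_nth_PiE[of S]] finite_PiE[of UNIV S] by simp

section \<open>The line with unit gaps\<close>

text \<open>
  The gaps are opened in the coordinate \<open>- x\<close> because a minimum of monomials with increasing
  coefficient increments changes its dominant exponent at the negatives of these increments.
\<close>

definition gapped_line :: "int set \<Rightarrow> real set" where
  "gapped_line \<Gamma> = {x. \<forall>g\<in>\<Gamma>. \<not> (of_int g < - x \<and> - x < of_int g + 1)}"

lemma interval_not_isolated:
  fixes x :: real
  assumes "a < b" "x \<in> {a..b}" "{a<..<b} \<subseteq> X"
  shows "\<not> x isolated_in X"
proof
  assume "x isolated_in X"
  then obtain e where "x \<in> X" and e: "e > 0" "\<And>y. y \<in> X \<Longrightarrow> dist x y < e \<Longrightarrow> y = x"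
    by (metis isolated_in_def isolated_inE_dist)
  define p where "p = max a (x - e)"
  define q where "q = min b (x + e)"
  have pq: "p < q" using assms(1,2) e(1) by (auto simp: p_def q_def)
  have "{p<..<q} \<subseteq> X" "\<And>y. y \<in> {p<..<q} \<Longrightarrow> dist x y < e"
    using assms(3) by (auto simp: p_def q_def dist_real_def)
  then have "{p<..<q} \<subseteq> {x}" using e(2) by blast
  then have "finite {p<..<q}" by (rule finite_subset) simp
  then show False using pq infinite_Ioo by blast
qed

text \<open>
  The line is cut at integers only, so around any remaining point other than an integer both of whose
  neighbouring unit intervals are gaps, a whole unit interval ending at or containing the point survives.
\<close>

lemma isolated_in_gapped_line:
  "{x. x isolated_in gapped_line \<Gamma>} = (\<lambda>r. - real_of_int r) ` {r \<in> \<Gamma>. r - 1 \<in> \<Gamma>}"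
proof (intro equalityI subsetI)
  fix x assume "x \<in> {x. x isolated_in gapped_line \<Gamma>}"
  then have iso: "x isolated_in gapped_line \<Gamma>" by simp
  then have X: "x \<in> gapped_line \<Gamma>" by (simp add: isolated_in_def)
  have free: "{- of_int r - 1<..<- of_int r} \<subseteq> gapped_line \<Gamma>" if "r \<notin> \<Gamma>" for r
  proof
    fix z :: real assume z: "z \<in> {- of_int r - 1<..<- of_int r}"
    have "g = r" if "of_int g < - z" "- z < of_int g + 1" for g :: int
      using that z by auto
    then show "z \<in> gapped_line \<Gamma>" using \<open>r \<notin> \<Gamma>\<close> by (auto simp: gapped_line_def)
  qed
  define r where "r = \<lfloor>- x\<rfloor>"
  have r: "of_int r \<le> - x" "- x < of_int r + 1" unfolding r_def by linarith+
  have in1: "r \<in> \<Gamma>"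
    using interval_not_isolated[OF _ _ free, of r x] iso r by fastforce
  then have eq: "- x = of_int r" using X r by (fastforce simp: gapped_line_def)
  \<comment> \<open>At an integer the interval on the other side must be a gap, too.\<close>
  have "r - 1 \<in> \<Gamma>"
    using interval_not_isolated[OF _ _ free, of "r - 1" x] iso eq by fastforce
  then show "x \<in> (\<lambda>r. - real_of_int r) ` {r \<in> \<Gamma>. r - 1 \<in> \<Gamma>}"
    using in1 eq by (intro image_eqI[of _ _ r]) auto
next
  fix x assume "x \<in> (\<lambda>r. - real_of_int r) ` {r \<in> \<Gamma>. r - 1 \<in> \<Gamma>}"
  then obtain r where r: "r \<in> \<Gamma>" "r - 1 \<in> \<Gamma>" and x: "x = - of_int r" by blast
  have "x \<in> gapped_line \<Gamma>" unfolding gapped_line_def x by auto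
  moreover have "z = x" if "z \<in> ball x 1" "z \<in> gapped_line \<Gamma>" for z
  proof -
    have "\<not> (of_int r < - z \<and> - z < of_int r + 1)"
      "\<not> (of_int (r - 1) < - z \<and> - z < of_int (r - 1) + 1)"
      using that(2) r unfolding gapped_line_def by blast+
    then show ?thesis using that(1) unfolding x by (auto simp: dist_real_def)
  qed
  ultimately show "x \<in> {x. x isolated_in gapped_line \<Gamma>}"
    unfolding isolated_in_def by (auto intro!: exI[of _ "ball x 1"])
qed

text \<open>
  Within a period of \<open>k + 1\<close> the first \<open>k\<close> unit intervals are gaps; the last one is kept so that
  neighbouring blocks share no endpoint, which would be one more isolated point.
\<close>

definition gap_starts :: "nat \<Rightarrow> nat \<Rightarrow> int set" where
  "gap_starts k d = {int (m * (k + 1) + j) | m j. m < d \<and> j < k}"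

lemma base_digits_unique:
  fixes m m' j j' K :: nat
  assumes "j < K" "j' < K" "m * K + j = m' * K + j'"
  shows "m = m' \<and> j = j'"
proof -
  have "(m * K + j) div K = m" "(m' * K + j') div K = m'" using assms(1,2) by auto
  then have "m = m'" using assms(3) by simp
  then show ?thesis using assms(3) by simp
qed

lemma adjacent_gap_starts:
  "{r \<in> gap_starts k d. r - 1 \<in> gap_starts k d} =
     (\<lambda>(m, j). int (m * (k + 1) + j)) ` ({..<d} \<times> {1..<k})"
proof (intro equalityI subsetI)
  fix r assume "r \<in> {r \<in> gap_starts k d. r - 1 \<in> gap_starts k d}"
  then obtain m j m' j' where r: "r = int (m * (k + 1) + j)" "m < d" "j < k"
    and r': "r - 1 = int (m' * (k + 1) + j')" "m' < d" "j' < k"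
    unfolding gap_starts_def by blast
  have "int (m * (k + 1) + j) = int (m' * (k + 1) + (j' + 1))" using r(1) r'(1) by simp
  then have "m * (k + 1) + j = m' * (k + 1) + (j' + 1)" by linarith
  \<comment> \<open>Both \<open>j\<close> and \<open>j' + 1 \<le> k\<close> are digits to base \<open>k + 1\<close>, so no carry occurs.\<close>
  then have "j = j' + 1" using base_digits_unique[of j "k + 1" "j' + 1" m m'] r(3) r'(3) by simp
  then have "(m, j) \<in> {..<d} \<times> {1..<k}" using r by simp
  then show "r \<in> (\<lambda>(m, j). int (m * (k + 1) + j)) ` ({..<d} \<times> {1..<k})"
    using r(1) by (intro image_eqI[of _ _ "(m, j)"]) auto
next
  fix r assume "r \<in> (\<lambda>(m, j). int (m * (k + 1) + j)) ` ({..<d} \<times> {1..<k})"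
  then obtain m j where r: "r = int (m * (k + 1) + j)" "m < d" "1 \<le> j" "j < k" by auto
  have "r \<in> gap_starts k d" unfolding gap_starts_def using r by blast
  moreover have "r - 1 = int (m * (k + 1) + (j - 1))" "j - 1 < k" using r by auto
  then have "r - 1 \<in> gap_starts k d" unfolding gap_starts_def using r(2) by blast
  ultimately show "r \<in> {r \<in> gap_starts k d. r - 1 \<in> gap_starts k d}" by simp
qed

lemma card_adjacent_gap_starts:
  "card {r \<in> gap_starts k d. r - 1 \<in> gap_starts k d} = (k - 1) * d"
proof -
  have "inj_on (\<lambda>(m, j). int (m * (k + 1) + j)) ({..<d} \<times> {1..<k})"
  proof (intro inj_onI, clarify)
    fix m j m' j' assume j: "j \<in> {1..<k}" "j' \<in> {1..<k}"
      and "int (m * (k + 1) + j) = int (m' * (k + 1) + j')"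
    then have "m * (k + 1) + j = m' * (k + 1) + j'" by linarith
    then show "m = m' \<and> j = j'" using base_digits_unique[of j "k + 1" j' m m'] j by simp
  qed
  then show ?thesis unfolding adjacent_gap_starts by (simp add: card_image card_cartesian_product)
qed

section \<open>Tropical polynomials without odd-odd monomials\<close>

text \<open>
  In one variable, \<open>slope_sum u x a\<close> is the value at \<open>x\<close> of the monomial of exponent \<open>a\<close> whose
  coefficient is the sum of the first \<open>a\<close> terms of \<open>u\<close>. Written this way its increments in \<open>a\<close>
  are \<open>u s + x\<close>, so minimisation over \<open>a\<close> is a question about signs.
\<close>

definition slope_sum :: "(nat \<Rightarrow> real) \<Rightarrow> real \<Rightarrow> nat \<Rightarrow> real" where
  "slope_sum u x a = (\<Sum>s<a. u s + x)"

lemma slope_sum_diff: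
  "a \<le> b \<Longrightarrow> slope_sum u x b - slope_sum u x a = (\<Sum>s\<in>{a..<b}. u s + x)"
  unfolding slope_sum_def using sum_diff_nat_ivl[of 0 a b "\<lambda>s. u s + x"] by (simp only: lessThan_atLeast0)

text \<open>
  A certificate, by the signs of the increments, that exponent \<open>c\<close> attains the minimum over all
  exponents up to \<open>N\<close>. It is easy to check and also locates the ties.
\<close>

definition slope_split :: "(nat \<Rightarrow> real) \<Rightarrow> nat \<Rightarrow> real \<Rightarrow> nat \<Rightarrow> bool" where
  "slope_split u N x c \<longleftrightarrow> c \<le> N \<and> (\<forall>s<c. u s + x \<le> 0) \<and> (\<forall>s. c \<le> s \<and> s < N \<longrightarrow> 0 \<le> u s + x)"

lemma slope_split_min:
  assumes "slope_split u N x c" "a \<le> N"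
  shows "slope_sum u x c \<le> slope_sum u x a"
proof (cases "c \<le> a")
  case True
  have "0 \<le> (\<Sum>s\<in>{c..<a}. u s + x)"
    using assms by (intro sum_nonneg) (auto simp: slope_split_def)
  then show ?thesis using slope_sum_diff[OF True, of u x] by simp
next
  case False
  have "(\<Sum>s\<in>{a..<c}. u s + x) \<le> 0"
    using assms by (intro sum_nonpos) (auto simp: slope_split_def)
  then show ?thesis using slope_sum_diff[of a c u x] False by simp
qed

text \<open>
  The increments between \<open>a\<close> and the minimiser \<open>c\<close> all have the same weak sign, so the two values can
  agree only if every one of these increments is zero.
\<close>

lemma slope_split_eq:
  assumes "slope_split u N x c" "a \<le> N" "slope_sum u x a \<le> slope_sum u x c"
    and "min a c \<le> s" "s < max a c"
  shows "u s + x = 0"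
proof (cases "c \<le> a")
  case True
  have nn: "\<And>s. s \<in> {c..<a} \<Longrightarrow> 0 \<le> u s + x" using assms by (auto simp: slope_split_def)
  have "(\<Sum>s\<in>{c..<a}. u s + x) \<le> 0" using slope_sum_diff[OF True, of u x] assms(3) by simp
  then have "(\<Sum>s\<in>{c..<a}. u s + x) = 0" using sum_nonneg[of "{c..<a}" "\<lambda>s. u s + x"] nn by simp
  then show ?thesis using sum_nonneg_eq_0_iff[of "{c..<a}" "\<lambda>s. u s + x"] nn assms(4,5) True by auto
next
  case False
  have np: "\<And>s. s \<in> {a..<c} \<Longrightarrow> u s + x \<le> 0" using assms by (auto simp: slope_split_def)
  have "(\<Sum>s\<in>{a..<c}. u s + x) \<ge> 0" using slope_sum_diff[of a c u x] False assms(3) by simp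
  then have "(\<Sum>s\<in>{a..<c}. - (u s + x)) = 0"
    unfolding sum_negf using sum_nonpos[of "{a..<c}" "\<lambda>s. u s + x"] np by simp
  moreover have "0 \<le> - (u s + x)" if "s \<in> {a..<c}" for s using np[OF that] by simp
  ultimately have "- (u s + x) = 0" if "s \<in> {a..<c}" for s
    using sum_nonneg_eq_0_iff[of "{a..<c}" "\<lambda>s. - (u s + x)"] that by blast
  then show ?thesis using assms(4,5) False by force
qed

lemma slope_split_unique:
  assumes "slope_split u N x c" "a \<le> N" "slope_sum u x a \<le> slope_sum u x c"
    and "\<And>s. s < N \<Longrightarrow> u s + x \<noteq> 0"
  shows "a = c"
proof (rule ccontr)
  assume "a \<noteq> c"
  then have "min a c < max a c" "min a c < N" using assms(1,2) by (auto simp: slope_split_def)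
  then show False using slope_split_eq[OF assms(1-3), of "min a c"] assms(4) by auto
qed

text \<open>
  Separated coefficients make the minimisations over the two exponents independent, up to the
  parity condition; the exponents excluded by it are what interrupts the horizontal lines.
\<close>

definition checkered_poly ::
  "'n \<Rightarrow> 'n \<Rightarrow> nat \<Rightarrow> (nat \<Rightarrow> real) \<Rightarrow> (nat \<Rightarrow> real) \<Rightarrow> 'n::finite trop_poly" where
  "checkered_poly i i' N u v = (\<lambda>e.
     if (\<forall>l. l \<noteq> i \<and> l \<noteq> i' \<longrightarrow> e $ l = 0) \<and> e $ i \<le> N \<and> e $ i' \<le> N \<and> (even (e $ i) \<or> even (e $ i'))
     then Some ((\<Sum>s<e $ i. u s) + (\<Sum>s<e $ i'. v s)) else None)"

definition two_exponents :: "'n \<Rightarrow> 'n \<Rightarrow> nat \<Rightarrow> nat \<Rightarrow> nat ^ 'n::finite" where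
  "two_exponents i i' a b = (\<chi> l. if l = i then a else if l = i' then b else 0)"

lemma two_exponents_nth [simp]:
  "two_exponents i i' a b $ i = a"
  "i \<noteq> i' \<Longrightarrow> two_exponents i i' a b $ i' = b"
  "l \<noteq> i \<Longrightarrow> l \<noteq> i' \<Longrightarrow> two_exponents i i' a b $ l = 0"
  by (auto simp: two_exponents_def)

lemma dom_checkered_poly:
  assumes "i \<noteq> i'"
  shows "dom (checkered_poly i i' N u v) =
    (\<lambda>(a, b). two_exponents i i' a b) ` {(a, b). a \<le> N \<and> b \<le> N \<and> (even a \<or> even b)}"
proof (intro equalityI subsetI)
  fix e assume "e \<in> dom (checkered_poly i i' N u v)"
  then have e: "\<forall>l. l \<noteq> i \<and> l \<noteq> i' \<longrightarrow> e $ l = 0" "e $ i \<le> N" "e $ i' \<le> N" "even (e $ i) \<or> even (e $ i')"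
    by (auto simp: checkered_poly_def dom_def split: if_splits)
  have "e = two_exponents i i' (e $ i) (e $ i')"
    using e(1) by (auto simp: vec_eq_iff two_exponents_def)
  then show "e \<in> (\<lambda>(a, b). two_exponents i i' a b) ` {(a, b). a \<le> N \<and> b \<le> N \<and> (even a \<or> even b)}"
    using e by (intro image_eqI[of _ _ "(e $ i, e $ i')"]) auto
qed (use assms in \<open>auto simp: checkered_poly_def\<close>)

lemma finite_dom_checkered_poly:
  assumes "i \<noteq> i'"
  shows "finite (dom (checkered_poly i i' N u v))"
  unfolding dom_checkered_poly[OF assms]
  by (rule finite_imageI, rule finite_subset[of _ "{..N} \<times> {..N}"]) auto

lemma two_exponents_eq_iff:
  assumes "i \<noteq> i'"
  shows "two_exponents i i' a b = two_exponents i i' a' b' \<longleftrightarrow> a = a' \<and> b = b'"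
proof
  assume eq: "two_exponents i i' a b = two_exponents i i' a' b'"
  have "two_exponents i i' a b $ l = two_exponents i i' a' b' $ l" for l
    by (simp only: eq)
  from this[of i] this[of i'] show "a = a' \<and> b = b'" using assms by simp
qed simp

lemma sum_two_coordinates:
  fixes h :: "'n::finite \<Rightarrow> 'b::comm_monoid_add"
  assumes "i \<noteq> i'" "\<And>l. l \<noteq> i \<Longrightarrow> l \<noteq> i' \<Longrightarrow> h l = 0"
  shows "(\<Sum>l\<in>UNIV. h l) = h i + h i'"
proof -
  have "(\<Sum>l\<in>UNIV. h l) = (\<Sum>l\<in>{i, i'}. h l)"
    by (rule sum.mono_neutral_right) (use assms(2) in auto)
  then show ?thesis using assms(1) by simp
qed

lemma checkered_poly_two_exponents:
  assumes "i \<noteq> i'" "a \<le> N" "b \<le> N" "even a \<or> even b"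
  shows "checkered_poly i i' N u v (two_exponents i i' a b) = Some ((\<Sum>s<a. u s) + (\<Sum>s<b. v s))"
  using assms by (simp add: checkered_poly_def)

lemma trop_monom_checkered_poly:
  assumes "i \<noteq> i'" "a \<le> N" "b \<le> N" "even a \<or> even b"
  shows "trop_monom (checkered_poly i i' N u v) (two_exponents i i' a b) x =
    slope_sum u (x $ i) a + slope_sum v (x $ i') b"
proof -
  have "(\<Sum>l\<in>UNIV. real (two_exponents i i' a b $ l) * x $ l) = real a * x $ i + real b * x $ i'"
    by (subst sum_two_coordinates[OF assms(1)]) (use assms(1) in auto)
  then show ?thesis
    by (simp add: trop_monom_def checkered_poly_two_exponents[OF assms] slope_sum_def sum.distrib)
qed

lemma is_trop_poly_checkered_poly: "i \<noteq> i' \<Longrightarrow> is_trop_poly (checkered_poly i i' N u v)"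
  using finite_dom_checkered_poly[of i i' N u v] checkered_poly_two_exponents[of i i' 0 N 0 u v]
  by (auto simp: is_trop_poly_def)

text \<open>
  Evenness of \<open>N\<close> keeps the corner monomial with exponents \<open>(N, N)\<close>.
\<close>

lemma trop_degree_checkered_poly:
  fixes i :: "'n::finite"
  assumes "i \<noteq> i'" "even N"
  shows "trop_degree (checkered_poly i i' N u v) = 2 * N"
proof -
  have sum: "(\<Sum>l\<in>UNIV. two_exponents i i' a b $ l) = a + b" for a b
    by (subst sum_two_coordinates[OF assms(1)]) (use assms(1) in auto)
  show ?thesis unfolding trop_degree_def
  proof (rule Max_eqI)
    show "finite ((\<lambda>e. \<Sum>l\<in>UNIV. e $ l) ` dom (checkered_poly i i' N u v))"
      using finite_dom_checkered_poly[OF assms(1)] by blast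
    show "y \<le> 2 * N" if "y \<in> (\<lambda>e. \<Sum>l\<in>UNIV. e $ l) ` dom (checkered_poly i i' N u v)" for y
      using that unfolding dom_checkered_poly[OF assms(1)] by (auto simp: sum)
    show "2 * N \<in> (\<lambda>e. \<Sum>l\<in>UNIV. e $ l) ` dom (checkered_poly i i' N u v)"
      using assms checkered_poly_two_exponents[of i i' N N N u v]
      by (intro image_eqI[of _ _ "two_exponents i i' N N"]) (auto simp: sum)
  qed
qed

lemma trop_zero_iff:
  assumes "finite (dom f)"
  shows "trop_zero f x \<longleftrightarrow> (\<exists>e\<in>dom f. \<exists>e'\<in>dom f. e \<noteq> e' \<and>
    (\<forall>e''\<in>dom f. trop_monom f e x \<le> trop_monom f e'' x) \<and>
    (\<forall>e''\<in>dom f. trop_monom f e' x \<le> trop_monom f e'' x))"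
proof -
  have "trop_monom f e x = trop_eval f x \<longleftrightarrow> (\<forall>e''\<in>dom f. trop_monom f e x \<le> trop_monom f e'' x)"
    if "e \<in> dom f" for e
  proof -
    let ?A = "(\<lambda>e. trop_monom f e x) ` dom f"
    have "trop_monom f e x = trop_eval f x \<longleftrightarrow> Min ?A = trop_monom f e x"
      unfolding trop_eval_def by (rule eq_commute)
    also have "\<dots> \<longleftrightarrow> trop_monom f e x \<in> ?A \<and> (\<forall>y\<in>?A. trop_monom f e x \<le> y)"
      by (rule Min_eq_iff) (use that assms in blast)+
    also have "\<dots> \<longleftrightarrow> (\<forall>e''\<in>dom f. trop_monom f e x \<le> trop_monom f e'' x)"
      using that by blast
    finally show ?thesis .
  qed
  then show ?thesis unfolding trop_zero_def by blast
qed

text \<open>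
  The translation to exponent pairs: from here on tropical zeros are pairs of distinct minimisers of
  a separated function on the checkered square.
\<close>

lemma trop_zero_checkered_poly_iff:
  assumes "i \<noteq> i'"
  shows "trop_zero (checkered_poly i i' N u v) x \<longleftrightarrow>
    (let D = {(a, b). a \<le> N \<and> b \<le> N \<and> (even a \<or> even b)};
         M = (\<lambda>(a, b). slope_sum u (x $ i) a + slope_sum v (x $ i') b)
     in \<exists>p\<in>D. \<exists>q\<in>D. p \<noteq> q \<and> (\<forall>r\<in>D. M p \<le> M r) \<and> (\<forall>r\<in>D. M q \<le> M r))"
proof -
  let ?D = "{(a, b). a \<le> N \<and> b \<le> N \<and> (even a \<or> even b)}"
  let ?f = "checkered_poly i i' N u v"
  let ?M = "\<lambda>(a, b). slope_sum u (x $ i) a + slope_sum v (x $ i') b"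
  let ?t = "\<lambda>(a, b). two_exponents i i' a b"
  have M: "trop_monom ?f (?t p) x = ?M p" if "p \<in> ?D" for p
    using that trop_monom_checkered_poly[OF assms] by auto
  have t: "?t p = ?t q \<longleftrightarrow> p = q" for p q
    using two_exponents_eq_iff[OF assms] by (auto split: prod.splits)
  have "trop_zero ?f x \<longleftrightarrow> (\<exists>p\<in>?D. \<exists>q\<in>?D. ?t p \<noteq> ?t q \<and>
      (\<forall>r\<in>?D. trop_monom ?f (?t p) x \<le> trop_monom ?f (?t r) x) \<and>
      (\<forall>r\<in>?D. trop_monom ?f (?t q) x \<le> trop_monom ?f (?t r) x))"
    unfolding trop_zero_iff[OF finite_dom_checkered_poly[OF assms]] dom_checkered_poly[OF assms]
    by (simp only: bex_simps(7) ball_simps(9))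
  also have "\<dots> \<longleftrightarrow> (\<exists>p\<in>?D. \<exists>q\<in>?D. p \<noteq> q \<and> (\<forall>r\<in>?D. ?M p \<le> ?M r) \<and> (\<forall>r\<in>?D. ?M q \<le> ?M r))"
    by (intro bex_cong refl arg_cong2[of _ _ _ _ "(\<and>)"] ball_cong) (simp_all only: M t)
  finally show ?thesis unfolding Let_def .
qed

text \<open>
  An even exponent \<open>c\<close> of the first variable may be combined with every exponent of the second, so a
  tie in the second variable is a tie of the polynomial.
\<close>

lemma checkered_zero_if_even_split:
  assumes "i \<noteq> i'" "slope_split u N (x $ i) c" "even c"
    and "slope_split v N (x $ i') b" "slope_split v N (x $ i') b'" "b \<noteq> b'"
  shows "trop_zero (checkered_poly i i' N u v) x"
proof -
  let ?D = "{(a, b). a \<le> N \<and> b \<le> N \<and> (even a \<or> even b)}"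
  let ?M = "\<lambda>(a, b). slope_sum u (x $ i) a + slope_sum v (x $ i') b"
  have "(c, b) \<in> ?D" "(c, b') \<in> ?D" "(c, b) \<noteq> (c, b')"
    using assms by (auto simp: slope_split_def)
  moreover have "\<forall>r\<in>?D. ?M (c, b) \<le> ?M r" "\<forall>r\<in>?D. ?M (c, b') \<le> ?M r"
    using slope_split_min[OF assms(2)] slope_split_min[OF assms(4)] slope_split_min[OF assms(5)]
    by (auto intro!: add_mono)
  ultimately show ?thesis
    unfolding trop_zero_checkered_poly_iff[OF assms(1)] Let_def by blast
qed

text \<open>
  If \<open>(c, b)\<close> is allowed and minimises both summands, it minimises the polynomial, and any other
  minimiser must minimise both summands as well. The last hypothesis quantifies only over exponents
  compatible with \<open>c\<close>: for odd \<open>c\<close> a tie between an even and an odd exponent is thereby excluded, and this is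
  what opens a gap.
\<close>

lemma not_checkered_zero_if_unique:
  assumes "i \<noteq> i'" "slope_split u N (x $ i) c" "\<And>s. s < N \<Longrightarrow> u s + x $ i \<noteq> 0"
    and "slope_split v N (x $ i') b" "even c \<or> even b"
    and uniq: "\<And>b'. b' \<le> N \<Longrightarrow> even c \<or> even b' \<Longrightarrow>
       slope_sum v (x $ i') b' \<le> slope_sum v (x $ i') b \<Longrightarrow> b' = b"
  shows "\<not> trop_zero (checkered_poly i i' N u v) x"
proof -
  let ?D = "{(a, b). a \<le> N \<and> b \<le> N \<and> (even a \<or> even b)}"
  let ?M = "\<lambda>(a, b). slope_sum u (x $ i) a + slope_sum v (x $ i') b"
  have D: "(c, b) \<in> ?D" using assms(2,4,5) by (auto simp: slope_split_def)
  have uniq': "p = (c, b)" if p: "p \<in> ?D" "?M p \<le> ?M (c, b)" for p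
  proof -
    obtain a' b' where p': "p = (a', b')" "a' \<le> N" "b' \<le> N" "even a' \<or> even b'"
      using p(1) by auto
    have ge: "slope_sum u (x $ i) c \<le> slope_sum u (x $ i) a'"
      "slope_sum v (x $ i') b \<le> slope_sum v (x $ i') b'"
      using slope_split_min assms(2,4) p' by blast+
    with p(2) have le: "slope_sum u (x $ i) a' \<le> slope_sum u (x $ i) c"
      "slope_sum v (x $ i') b' \<le> slope_sum v (x $ i') b"
      by (auto simp: p'(1))
    have "a' = c" using slope_split_unique[OF assms(2) p'(2) le(1) assms(3)] .
    moreover have "b' = b" using uniq[OF p'(3) _ le(2)] p'(4) \<open>a' = c\<close> by simp
    ultimately show ?thesis using p'(1) by simp
  qed
  show ?thesis
  proof
    assume "trop_zero (checkered_poly i i' N u v) x"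
    then obtain p q where "p \<in> ?D" "q \<in> ?D" "p \<noteq> q" "\<forall>r\<in>?D. ?M p \<le> ?M r" "\<forall>r\<in>?D. ?M q \<le> ?M r"
      unfolding trop_zero_checkered_poly_iff[OF assms(1)] Let_def by blast
    then show False using uniq'[of p] uniq'[of q] D by blast
  qed
qed

section \<open>Polynomials with prescribed gaps and their common zeros\<close>

text \<open>
  The points where the dominant \<open>x\<close>-exponent changes, in the coordinate \<open>- x\<close>: exponent \<open>2 m + 1\<close>
  dominates exactly between the knots \<open>2 m\<close> and \<open>2 m + 1\<close>, which are the ends of the \<open>m\<close>-th gap.
\<close>

definition knot :: "nat \<Rightarrow> nat \<Rightarrow> nat \<Rightarrow> real" where
  "knot k j s = real ((s div 2) * (k + 1) + j + s mod 2)"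

lemma knot_bounds:
  "real ((s div 2) * (k + 1) + j) \<le> knot k j s" "knot k j s \<le> real ((s div 2) * (k + 1) + j) + 1"
  unfolding knot_def by auto

lemma less_imp_mult_add_le:
  fixes m m' K :: nat
  shows "m < m' \<Longrightarrow> m * K + K \<le> m' * K"
  using mult_le_mono1[of "Suc m" m' K] by simp

lemma knot_split_in_gap:
  assumes "m < d" "k \<ge> 1" "real (m * (k + 1) + j) < - x" "- x < real (m * (k + 1) + j) + 1"
  shows "slope_split (knot k j) (2 * d) x (2 * m + 1)"
    and "\<And>s. s < 2 * d \<Longrightarrow> knot k j s + x \<noteq> 0"
proof -
  have lo: "knot k j s + x < 0" if "s < 2 * m + 1" for s
  proof (cases "s = 2 * m")
    case True
    then show ?thesis using assms(3) by (simp add: knot_def)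
  next
    case False
    then have "s div 2 < m" using that by linarith
    from less_imp_mult_add_le[OF this, of "k + 1"]
    have "real ((s div 2) * (k + 1) + j) + 1 \<le> real (m * (k + 1) + j)"
      using assms(2) by linarith
    then show ?thesis using knot_bounds(2)[of k j s] assms(3) by linarith
  qed
  have hi: "0 < knot k j s + x" if "2 * m + 1 \<le> s" for s
  proof (cases "s = 2 * m + 1")
    case True
    then show ?thesis using assms(4) by (simp add: knot_def)
  next
    case False
    then have "m < s div 2" using that by linarith
    from less_imp_mult_add_le[OF this, of "k + 1"]
    have "real (m * (k + 1) + j) + 1 \<le> real ((s div 2) * (k + 1) + j)"
      by linarith
    then show ?thesis using knot_bounds(1)[of s k j] assms(4) by linarith
  qed
  show "slope_split (knot k j) (2 * d) x (2 * m + 1)"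
    using assms(1) lo hi by (force simp: slope_split_def)
  show "knot k j s + x \<noteq> 0" if "s < 2 * d" for s
    using lo[of s] hi[of s] by linarith
qed

text \<open>
  The minimiser is twice the number of gaps to the left of \<open>- x\<close>. Gap endpoints are included: there an
  even exponent is still among the minimisers.
\<close>

lemma knot_split_outside_gaps:
  assumes "\<And>m. m < d \<Longrightarrow> - x \<le> real (m * (k + 1) + j) \<or> real (m * (k + 1) + j) + 1 \<le> - x"
  shows "\<exists>c. even c \<and> slope_split (knot k j) (2 * d) x c"
proof -
  define P where "P c \<longleftrightarrow> c = d \<or> - x \<le> real (c * (k + 1) + j)" for c
  define c where "c = (LEAST c. P c)"
  have Pc: "P c" unfolding c_def by (rule LeastI[of P d]) (simp add: P_def)
  have cd: "c \<le> d" unfolding c_def by (rule Least_le) (simp add: P_def)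
  have "knot k j s + x \<le> 0" if "s < 2 * c" for s
  proof -
    have s: "s div 2 < c" using that by linarith
    then have "\<not> P (s div 2)" using not_less_Least unfolding c_def by blast
    then have "real ((s div 2) * (k + 1) + j) + 1 \<le> - x"
      using assms[of "s div 2"] s cd by (auto simp: P_def)
    then show ?thesis using knot_bounds(2)[of k j s] by linarith
  qed
  moreover have "0 \<le> knot k j s + x" if s: "2 * c \<le> s" "s < 2 * d" for s
  proof -
    have "c \<le> s div 2" "c < d" using s by linarith+
    then have "c * (k + 1) \<le> (s div 2) * (k + 1)" by (intro mult_le_mono1)
    moreover have "- x \<le> real (c * (k + 1) + j)" using Pc \<open>c < d\<close> by (auto simp: P_def)
    ultimately show ?thesis using knot_bounds(1)[of s k j] by linarith
  qed
  ultimately show ?thesis using cd by (intro exI[of _ "2 * c"]) (auto simp: slope_split_def)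
qed

text \<open>
  The indices \<open>0\<close> and \<open>2\<close> suffice: their closed gaps have length one and start two apart, and the
  period \<open>k + 1 \<ge> 4\<close> keeps a gap of index \<open>2\<close> away from the next one of index \<open>0\<close>.
\<close>

lemma exists_generic_index:
  assumes "k \<ge> 3"
  shows "\<exists>j<k. \<forall>m. t < real (m * (k + 1) + j) \<or> real (m * (k + 1) + j) + 1 < t"
proof (rule ccontr)
  assume "\<not> ?thesis"
  then have "\<exists>m. real (m * (k + 1) + j) \<le> t \<and> t \<le> real (m * (k + 1) + j) + 1" if "j < k" for j
    using that by (auto simp: not_less dest!: spec[of _ j])
  from this[of 0] this[of 2] assms obtain m m' where
    m: "real (m * (k + 1)) \<le> t" "t \<le> real (m * (k + 1)) + 1"
       "real (m' * (k + 1) + 2) \<le> t" "t \<le> real (m' * (k + 1) + 2) + 1"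
    by auto
  have "m' < m"
  proof (rule ccontr)
    assume "\<not> m' < m"
    then have "m * (k + 1) \<le> m' * (k + 1)" by (intro mult_le_mono1) simp
    then show False using m(2,3) by linarith
  qed
  from less_imp_mult_add_le[OF this, of "k + 1"] show False using m(1,4) assms by linarith
qed

lemma integer_split_exists:
  assumes "\<And>s. s < N \<Longrightarrow> real s + y \<noteq> 0"
  shows "\<exists>b. slope_split real N y b"
proof -
  define P where "P b \<longleftrightarrow> b = N \<or> 0 \<le> real b + y" for b
  define b where "b = (LEAST b. P b)"
  have Pb: "P b" unfolding b_def by (rule LeastI[of P N]) (simp add: P_def)
  have bN: "b \<le> N" unfolding b_def by (rule Least_le) (simp add: P_def)
  have "real s + y \<le> 0" if "s < b" for s
    using not_less_Least[of s P] that by (auto simp: P_def b_def)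
  moreover have "0 \<le> real s + y" if "b \<le> s" "s < N" for s
    using Pb that by (auto simp: P_def)
  ultimately show ?thesis using bN by (auto simp: slope_split_def)
qed

lemma integer_split_at:
  assumes "s < N"
  shows "slope_split real N (- real s) s" "slope_split real N (- real s) (Suc s)"
  using assms by (auto simp: slope_split_def)

definition gap_poly :: "nat \<Rightarrow> nat \<Rightarrow> 'n \<Rightarrow> 'n \<times> nat \<Rightarrow> 'n::finite trop_poly" where
  "gap_poly k d i' = (\<lambda>(i, j). checkered_poly i i' (2 * d) (knot k j) real)"

definition in_gap :: "nat \<Rightarrow> nat \<Rightarrow> nat \<Rightarrow> real \<Rightarrow> bool" where
  "in_gap k d j x \<longleftrightarrow> (\<exists>m<d. real (m * (k + 1) + j) < - x \<and> - x < real (m * (k + 1) + j) + 1)"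

lemma gapped_line_gap_starts:
  "x \<in> gapped_line (gap_starts k d) \<longleftrightarrow> (\<forall>j<k. \<not> in_gap k d j x)"
proof (intro iffI allI impI notI)
  fix j assume x: "x \<in> gapped_line (gap_starts k d)" and j: "j < k" and "in_gap k d j x"
  then obtain m where m: "m < d" "real (m * (k + 1) + j) < - x" "- x < real (m * (k + 1) + j) + 1"
    unfolding in_gap_def by auto
  have "int (m * (k + 1) + j) \<in> gap_starts k d" unfolding gap_starts_def using m(1) j by blast
  with x show False unfolding gapped_line_def using m(2,3) by (auto simp only: of_int_of_nat_eq)
next
  assume gaps: "\<forall>j<k. \<not> in_gap k d j x"
  have "\<not> (of_int g < - x \<and> - x < of_int g + 1)" if start: "g \<in> gap_starts k d" for g
  proof -
    obtain m j where g: "g = int (m * (k + 1) + j)" "m < d" "j < k"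
      using start unfolding gap_starts_def by blast
    with gaps have "\<not> in_gap k d j x" by blast
    then show ?thesis using g(2) unfolding in_gap_def g(1) of_int_of_nat_eq by blast
  qed
  then show "x \<in> gapped_line (gap_starts k d)" unfolding gapped_line_def by blast
qed

text \<open>
  On the line \<open>y = - s\<close> the minimising \<open>y\<close>-exponents are \<open>s\<close> and \<open>s + 1\<close>. Outside the gaps both are
  available together with an even \<open>x\<close>-exponent. Inside a gap the only minimising \<open>x\<close>-exponent is odd, and
  only the even one of \<open>s\<close>, \<open>s + 1\<close> may accompany it.
\<close>

lemma gap_poly_zero_on_grid:
  assumes "i \<noteq> i'" "k \<ge> 1" "s < 2 * d" "x $ i' = - real s"
  shows "trop_zero (gap_poly k d i' (i, j)) x \<longleftrightarrow> \<not> in_gap k d j (x $ i)"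
proof
  assume "\<not> in_gap k d j (x $ i)"
  then obtain c where "even c" "slope_split (knot k j) (2 * d) (x $ i) c"
    using knot_split_outside_gaps[of d "x $ i" k j] unfolding in_gap_def by force
  then show "trop_zero (gap_poly k d i' (i, j)) x"
    unfolding gap_poly_def prod.case
    using integer_split_at[OF assms(3)] assms(1,4)
    by (intro checkered_zero_if_even_split[where b = s and b' = "Suc s"]) auto
next
  assume zero: "trop_zero (gap_poly k d i' (i, j)) x"
  show "\<not> in_gap k d j (x $ i)"
  proof
    assume "in_gap k d j (x $ i)"
    then obtain m where m: "m < d" "real (m * (k + 1) + j) < - x $ i"
      "- x $ i < real (m * (k + 1) + j) + 1" unfolding in_gap_def by auto
    note split = knot_split_in_gap[OF m(1) assms(2) m(2,3)]
    \<comment> \<open>The member of the tie that survives next to an odd \<open>x\<close>-exponent.\<close>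
    define b where "b = (if even s then s else Suc s)"
    have b: "slope_split real (2 * d) (x $ i') b" "even b"
      using integer_split_at[OF assms(3)] by (auto simp: b_def assms(4))
    have "b' = b" if b': "b' \<le> 2 * d" "even b'"
      "slope_sum real (x $ i') b' \<le> slope_sum real (x $ i') b" for b'
    proof (rule ccontr)
      assume ne: "b' \<noteq> b"
      have "t = s" if "min b' b \<le> t" "t < max b' b" for t
        using slope_split_eq[OF b(1) b'(1,3) that] assms(4) by simp
      from this[of "min b' b"] this[of "max b' b - 1"] have "max b' b = Suc (min b' b)"
        using ne by (auto simp: min_def max_def split: if_splits)
      then show False using b(2) b'(2) by (metis even_Suc max_def min_def)
    qed
    then have "\<not> trop_zero (checkered_poly i i' (2 * d) (knot k j) real) x"
      using split b by (intro not_checkered_zero_if_unique[OF assms(1)]) auto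
    then show False using zero by (simp add: gap_poly_def)
  qed
qed

text \<open>
  Away from the closed gaps a single \<open>x\<close>-exponent dominates and it is even, so only a tie between
  \<open>y\<close>-exponents can produce a zero.
\<close>

lemma gap_poly_zero_imp_grid:
  assumes "i \<noteq> i'" "k \<ge> 1" "trop_zero (gap_poly k d i' (i, j)) x"
    and gen: "\<And>m. - x $ i < real (m * (k + 1) + j) \<or> real (m * (k + 1) + j) + 1 < - x $ i"
  shows "\<exists>s<2 * d. x $ i' = - real s"
proof (rule ccontr)
  assume "\<not> ?thesis"
  then have ne: "real s + x $ i' \<noteq> 0" if "s < 2 * d" for s
    using that by (metis add.commute eq_neg_iff_add_eq_0)
  then obtain b where b: "slope_split real (2 * d) (x $ i') b"
    using integer_split_exists by blast
  obtain c where c: "even c" "slope_split (knot k j) (2 * d) (x $ i) c"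
    using knot_split_outside_gaps[of d "x $ i" k j] gen by (meson less_imp_le)
  have "knot k j s + x $ i \<noteq> 0" for s
    using gen[of "s div 2"] knot_bounds[of s k j] knot_bounds[of k j s] by linarith
  then have "\<not> trop_zero (checkered_poly i i' (2 * d) (knot k j) real) x"
    using b c ne slope_split_unique[OF b]
    by (intro not_checkered_zero_if_unique[OF assms(1)]) auto
  then show False using assms(3) by (simp add: gap_poly_def)
qed

definition gap_system :: "nat \<Rightarrow> nat \<Rightarrow> 'n \<Rightarrow> 'n::finite trop_poly set" where
  "gap_system k d i' = gap_poly k d i' ` ((UNIV - {i'}) \<times> {..<k})"

lemma trop_solutions_gap_system:
  fixes i' :: "'n::finite"
  assumes "CARD('n) \<ge> 2" "k \<ge> 3"
  shows "trop_solutions (gap_system k d i') =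
    {x. \<forall>l. x $ l \<in> (if l = i' then (\<lambda>s. - real s) ` {..<2 * d} else gapped_line (gap_starts k d))}"
    (is "_ = {x. \<forall>l. x $ l \<in> ?S l}")
proof -
  have sol: "x \<in> trop_solutions (gap_system k d i') \<longleftrightarrow>
      (\<forall>i j. i \<noteq> i' \<and> j < k \<longrightarrow> trop_zero (gap_poly k d i' (i, j)) x)" for x
    by (auto simp: trop_solutions_def gap_system_def)
  have box: "(\<forall>l. x $ l \<in> ?S l) \<longleftrightarrow>
      (\<exists>s<2 * d. x $ i' = - real s) \<and> (\<forall>i j. i \<noteq> i' \<and> j < k \<longrightarrow> \<not> in_gap k d j (x $ i))" for x
    by (auto simp: gapped_line_gap_starts image_iff split: if_splits)
  have grid: "\<exists>s<2 * d. x $ i' = - real s"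
    if "\<forall>i j. i \<noteq> i' \<and> j < k \<longrightarrow> trop_zero (gap_poly k d i' (i, j)) x" for x :: "real ^ 'n"
  proof -
    have "UNIV \<noteq> {i'}"
    proof
      assume "UNIV = {i'}"
      then have "CARD('n) = card {i'}" by (rule arg_cong)
      then show False using assms(1) by simp
    qed
    then obtain i where i: "i \<noteq> i'" by auto
    obtain j where j: "j < k"
      "\<And>m. - x $ i < real (m * (k + 1) + j) \<or> real (m * (k + 1) + j) + 1 < - x $ i"
      using exists_generic_index[OF assms(2), of "- x $ i"] by blast
    show ?thesis
      using gap_poly_zero_imp_grid[OF i, of k d j x] assms(2) that i j by auto
  qed
  have k1: "k \<ge> 1" using assms(2) by simp
  have "x \<in> trop_solutions (gap_system k d i') \<longleftrightarrow> (\<forall>l. x $ l \<in> ?S l)" for x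
    unfolding sol box using grid[of x] gap_poly_zero_on_grid[OF _ k1, of _ i'] by blast
  then show ?thesis by blast
qed

text \<open>
  The coefficient of the linear monomial \<open>x $ i\<close> is the first knot, which is \<open>j\<close>.
\<close>

lemma inj_on_gap_poly:
  assumes "d \<ge> 1"
  shows "inj_on (gap_poly k d i') ((UNIV - {i'}) \<times> {..<k})"
proof (rule inj_onI)
  fix p q
  assume pq: "p \<in> (UNIV - {i'}) \<times> {..<k}" "q \<in> (UNIV - {i'}) \<times> {..<k}"
    "gap_poly k d i' p = gap_poly k d i' q"
  obtain i j l m where p: "p = (i, j)" and q: "q = (l, m)" by (metis surj_pair)
  have i: "i \<noteq> i'" and eq: "gap_poly k d i' (i, j) = gap_poly k d i' (l, m)"
    using pq by (auto simp: p q)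
  let ?e = "two_exponents i i' 1 0"
  have v: "gap_poly k d i' (i, j) ?e = Some (real j)"
    using checkered_poly_two_exponents[OF i, of 1 "2 * d" 0 "knot k j" real] assms
    by (simp add: gap_poly_def knot_def)
  have il: "i = l"
  proof (rule ccontr)
    assume "i \<noteq> l"
    then have "gap_poly k d i' (l, m) ?e = None"
      using i by (auto simp: gap_poly_def checkered_poly_def intro!: exI[of _ i])
    then show False using v eq by simp
  qed
  moreover have "gap_poly k d i' (l, m) ?e = Some (real m)"
    using checkered_poly_two_exponents[OF i, of 1 "2 * d" 0 "knot k m" real] assms il
    by (simp add: gap_poly_def knot_def)
  ultimately show "p = q" using v eq by (simp add: p q)
qed

definition isolated_grid :: "nat \<Rightarrow> nat \<Rightarrow> 'n \<Rightarrow> 'n \<Rightarrow> real set" where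
  "isolated_grid k d i' l =
    (if l = i' then (\<lambda>s. - real s) ` {..<2 * d}
     else (\<lambda>r. - real_of_int r) ` {r \<in> gap_starts k d. r - 1 \<in> gap_starts k d})"

lemma finite_isolated_grid: "finite (isolated_grid k d i' l)"
  unfolding isolated_grid_def adjacent_gap_starts by simp

lemma card_isolated_grid: "card (isolated_grid k d i' l) = (if l = i' then 2 * d else (k - 1) * d)"
  using card_adjacent_gap_starts[of k d]
  by (simp add: isolated_grid_def card_image inj_on_def)

lemma isolated_solutions_gap_system:
  fixes i' :: "'n::finite"
  assumes "CARD('n) \<ge> 2" "k \<ge> 3"
  shows "{x. x isolated_in trop_solutions (gap_system k d i')} = {x. \<forall>l. x $ l \<in> isolated_grid k d i' l}"
proof -
  have fin: "x isolated_in (\<lambda>s. - real s) ` {..<2 * d} \<longleftrightarrow> x \<in> (\<lambda>s. - real s) ` {..<2 * d}" for x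
    by (simp add: isolated_in_islimpt_iff islimpt_finite)
  have gap: "x isolated_in gapped_line (gap_starts k d) \<longleftrightarrow>
      x \<in> (\<lambda>r. - real_of_int r) ` {r \<in> gap_starts k d. r - 1 \<in> gap_starts k d}" for x
    using isolated_in_gapped_line[of "gap_starts k d"] by blast
  have "x $ l isolated_in (if l = i' then (\<lambda>s. - real s) ` {..<2 * d} else gapped_line (gap_starts k d))
      \<longleftrightarrow> x $ l \<in> isolated_grid k d i' l" for x :: "real ^ 'n" and l
    using fin gap by (simp add: isolated_grid_def)
  then show ?thesis
    unfolding trop_solutions_gap_system[OF assms] isolated_in_box_iff by simp
qed

lemma card_isolated_solutions_gap_system:
  fixes i' :: "'n::finite"
  assumes "CARD('n) \<ge> 2" "k \<ge> 3"
  shows "card {x. x isolated_in trop_solutions (gap_system k d i')}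
    = 2 * (k - 1) ^ (CARD('n) - 1) * d ^ CARD('n)"
proof -
  obtain N where N: "CARD('n) = Suc N" using assms(1) by (cases "CARD('n)") simp_all
  have "card {x. x isolated_in trop_solutions (gap_system k d i')}
      = (\<Prod>l\<in>UNIV. card (isolated_grid k d i' l))"
    unfolding isolated_solutions_gap_system[OF assms] by (rule card_box_vec)
  also have "\<dots> = 2 * d * (\<Prod>l\<in>UNIV - {i'}. card (isolated_grid k d i' l))"
    by (simp add: prod.remove[of UNIV i'] card_isolated_grid)
  also have "(\<Prod>l\<in>UNIV - {i'}. card (isolated_grid k d i' l)) = (\<Prod>l\<in>UNIV - {i'}. (k - 1) * d)"
    by (rule prod.cong) (simp_all add: card_isolated_grid)
  also have "\<dots> = ((k - 1) * d) ^ (CARD('n) - 1)" by simp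
  also have "2 * d * \<dots> = 2 * (k - 1) ^ (CARD('n) - 1) * d ^ CARD('n)"
    by (simp only: N) (simp add: power_mult_distrib)
  finally show ?thesis .
qed

lemma card_gap_system:
  fixes i' :: "'n::finite"
  assumes "d \<ge> 1"
  shows "card (gap_system k d i') = k * (CARD('n) - 1)"
  unfolding gap_system_def card_image[OF inj_on_gap_poly[OF assms]]
  by (simp add: card_cartesian_product)

lemma gap_system_degree:
  assumes "f \<in> gap_system k d i'"
  shows "is_trop_poly f" "trop_degree f = 4 * d"
proof -
  obtain i j where i: "i \<noteq> i'" and f: "f = checkered_poly i i' (2 * d) (knot k j) real"
    using assms by (auto simp: gap_system_def gap_poly_def)
  show "is_trop_poly f" unfolding f by (rule is_trop_poly_checkered_poly[OF i])
  show "trop_degree f = 4 * d" using trop_degree_checkered_poly[OF i, of "2 * d"] by (simp add: f)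
qed

theorem theorem8p1:
  fixes k d :: nat
  assumes "CARD('n::finite) \<ge> 2" and "k \<ge> 3" and "d \<ge> 1"
  shows "\<exists>F :: 'n trop_poly set.
           finite F \<and> card F = k * (CARD('n) - 1) \<and>
           (\<forall>f\<in>F. is_trop_poly f \<and> trop_degree f = 4 * d) \<and>
           finite {x. x isolated_in trop_solutions F} \<and>
           card {x. x isolated_in trop_solutions F}
             = 2 * (k - 1) ^ (CARD('n) - 1) * d ^ CARD('n)"
proof (intro exI conjI ballI)
  let ?F = "gap_system k d (undefined :: 'n)"
  show "finite ?F" by (simp add: gap_system_def)
  show "card ?F = k * (CARD('n) - 1)" using assms(3) by (rule card_gap_system)
  show "is_trop_poly f" "trop_degree f = 4 * d" if "f \<in> ?F" for f
    using that by (rule gap_system_degree)+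
  show "finite {x. x isolated_in trop_solutions ?F}"
    unfolding isolated_solutions_gap_system[OF assms(1,2)]
    using finite_isolated_grid by (rule finite_box_vec)
  show "card {x. x isolated_in trop_solutions ?F} = 2 * (k - 1) ^ (CARD('n) - 1) * d ^ CARD('n)"
    using assms(1,2) by (rule card_isolated_solutions_gap_system)
qed

end
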